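(* Let $n \ge 2$, let $P \in \mathbb{C}[X_1,\dots,X_n]$ be a non-constant reduced polynomial, and let $P=\prod_{i=1}^s P_i$ be its factorization into irreducible factors in $\mathbb{C}[X_1,\dots,X_n]$. Assume that $P$ is $X_1$-generic, let $v\in E(P)$, and let $\psi_v:\overline{E}(P)\to\overline{E}(P)$ be the associated endomorphism of the $s$-dimensional vector space $\overline{E}(P)$ (all defined in the context). If all the eigenvalues of $\psi_v$ are distinct, say $\lambda_1,\dots,\lambda_s$, then, up to a re-indexing of the factors $P_1,\dots,P_s$, one has $$P_i=\gcd\left(P,\;v-\lambda_i P_{X_1}\right)\quad\text{for } i=1,\dots,s,$$ where $P_{X_1}=\partial P/\partial X_1$ and equality of greatest common divisors is understood up to multiplication by a nonzero constant.
   Context: A polynomial is reduced if its irreducible factors are distinct (pairwise non-associate). $V(P)=\{x\in\mathbb{C}^n : P(x)=0\}$. $P$ is called $X_1$-generic if the restriction to the hypersurface $V(P)$ of the projection $\pi_1:\mathbb{C}^n\to\mathbb{C}^{n-1}$, $(x_1,x_2,\dots,x_n)\mapsto(x_2,\dots,x_n)$, has finite fibers. Let $m_i=\deg_{X_i}P$. The multidegree of a polynomial $Q$ is $\operatorname{multideg}(Q)=(\deg_{X_1}Q,\dots,\deg_{X_n}Q)$, and inequalities between multidegrees are componentwise; the zero polynomial satisfies every degree bound, and a bound $\deg_{X_i}\le -1$ forces the polynomial to be zero. $F(P)$ is the $\mathbb{C}$-vector space of all $A=(A_1,\dots,A_n)\in\mathbb{C}[X_1,\dots,X_n]^n$ such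 that $$\frac{\partial}{\partial X_i}\left(\frac{A_j}{P}\right)-\frac{\partial}{\partial X_j}\left(\frac{A_i}{P}\right)=0\quad\text{for all } 1\le i<j\le n,$$ and $$\operatorname{multideg}(A_i)\le (m_1,\dots,m_{i-1},m_i-1,m_{i+1},\dots,m_n)\quad\text{for all } i=1,\dots,n.$$ $E(P)=\operatorname{pr}_1(F(P))\subset\mathbb{C}[X_1,\dots,X_n]$, where $\operatorname{pr}_1(A_1,\dots,A_n)=A_1$. Let $Q(P)=\mathbb{C}[X_1,\dots,X_n]/(P)$, write $[f]$ for the class of $f$ in $Q(P)$, and let $\overline{E}(P)=\{[v] : v\in E(P)\}\subset Q(P)$ be the image of $E(P)$. Let $$\tilde{E}(P)=\{[v\cdot P_{X_1}] : v\in E(P)\}\subset Q(P).$$ When $P$ is $X_1$-generic, both $\overline{E}(P)$ and $\tilde{E}(P)$ have dimension $s$, and the map $\overline{E}(P)\to\tilde{E}(P)$, $[v]\mapsto[v\cdot P_{X_1}]$, is a linear isomorphism; let $S:\tilde{E}(P)\to\overline{E}(P)$ be its inverse. For $v\in E(P)$ let $\phi_v:Q(P)\to Q(P)$ be multiplication by $[v]$; it satisfies $\phi_v(\overline{E}(P))\subset\tilde{E}(P)$. The endomorphism $\psi_v$ of $\overline{E}(P)$ is $\psi_v=S\circ\phi_v|_{\overline{E}(P)}$. *)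

theory Defs
  imports
    Complex_Main
    "HOL-Library.Poly_Mapping"
    "HOL-Library.FuncSet"
    "HOL-Computational_Algebra.Fraction_Field"
    "HOL-Computational_Algebra.Factorial_Ring"
    "HOL-Algebra.QuotRing"
begin

section \<open>Polynomials in finitely many variables\<close>

text \<open>
  The variables \<open>X_1, \<dots>, X_n\<close> are indexed by a finite linearly ordered type \<open>'n\<close> with
  \<open>n = card (UNIV :: 'n set)\<close> elements, listed in increasing order; \<open>X_1\<close> belongs to the least index.
  A monomial is its exponent vector \<open>'n \<Rightarrow>\<^sub>0 nat\<close>, and a polynomial maps monomials to
  coefficients; ring operations and divisibility are the library ones.
\<close>

type_synonym 'n cpoly = "('n \<Rightarrow>\<^sub>0 nat) \<Rightarrow>\<^sub>0 complex"

definition var1 :: "'n :: {finite, linorder}" where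
  "var1 = Min UNIV"

definition Const :: "complex \<Rightarrow> 'n cpoly" where
  "Const c = Poly_Mapping.single 0 c"

definition peval :: "('n :: finite) cpoly \<Rightarrow> ('n \<Rightarrow> complex) \<Rightarrow> complex" where
  "peval p x = (\<Sum>m\<in>Poly_Mapping.keys p.
     Poly_Mapping.lookup p m * (\<Prod>i\<in>UNIV. x i ^ Poly_Mapping.lookup m i))"

definition deg_in :: "'n \<Rightarrow> 'n cpoly \<Rightarrow> nat" where
  "deg_in i p = Max (insert 0 ((\<lambda>m. Poly_Mapping.lookup m i) ` Poly_Mapping.keys p))"

text \<open>
  Bounds are integers because \<open>deg_in i P - 1\<close> may be \<open>-1\<close>. The zero polynomial satisfies every
  bound, and a nonzero one never satisfies the bound \<open>-1\<close>.
\<close>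
definition multideg_le :: "'n cpoly \<Rightarrow> ('n \<Rightarrow> int) \<Rightarrow> bool" where
  "multideg_le p b \<longleftrightarrow> p = 0 \<or> (\<forall>i. int (deg_in i p) \<le> b i)"

lift_definition pd :: "'n \<Rightarrow> 'n cpoly \<Rightarrow> 'n cpoly"
  is "\<lambda>i p m. of_nat (Poly_Mapping.lookup m i + 1) * p (m + Poly_Mapping.single i 1)"
proof -
  fix i :: 'n and p :: "('n \<Rightarrow>\<^sub>0 nat) \<Rightarrow> complex"
  assume fin: "finite {m. p m \<noteq> 0}"
  have "{m. of_nat (Poly_Mapping.lookup m i + 1) * p (m + Poly_Mapping.single i 1) \<noteq> 0}
      \<subseteq> (\<lambda>m. m - Poly_Mapping.single i 1) ` {m. p m \<noteq> 0}"
  proof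
    fix m assume "m \<in> {m. of_nat (Poly_Mapping.lookup m i + 1) * p (m + Poly_Mapping.single i 1) \<noteq> 0}"
    then have "m + Poly_Mapping.single i 1 \<in> {m. p m \<noteq> 0}" by auto
    moreover have "m = (m + Poly_Mapping.single i 1) - Poly_Mapping.single i 1" by simp
    ultimately show "m \<in> (\<lambda>m. m - Poly_Mapping.single i 1) ` {m. p m \<noteq> 0}" by blast
  qed
  then show "finite {m. of_nat (Poly_Mapping.lookup m i + 1) * p (m + Poly_Mapping.single i 1) \<noteq> 0}"
    using fin finite_surj by blast
qed

lemma pd_add: "pd i (p + q) = pd i p + pd i q"
  by (rule poly_mapping_eqI) (simp add: pd.rep_eq lookup_add algebra_simps)

lemma pd_zero [simp]: "pd i 0 = 0"
  by (rule poly_mapping_eqI) (simp add: pd.rep_eq)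

lemma pd_sum: "pd i (sum f A) = (\<Sum>a\<in>A. pd i (f a))"
  by (induction A rule: infinite_finite_induct) (simp_all add: pd_add)

lemma pd_single:
  "pd i (Poly_Mapping.single m c)
     = Poly_Mapping.single (m - Poly_Mapping.single i 1) (of_nat (Poly_Mapping.lookup m i) * c)"
proof (rule poly_mapping_eqI)
  fix k
  have *: "m = k + Poly_Mapping.single i 1 \<longleftrightarrow>
      m - Poly_Mapping.single i 1 = k \<and> Poly_Mapping.lookup m i \<noteq> 0"
  proof
    assume "m - Poly_Mapping.single i 1 = k \<and> Poly_Mapping.lookup m i \<noteq> 0"
    then have "k = m - Poly_Mapping.single i 1" and "Poly_Mapping.lookup m i \<noteq> 0" by auto
    then show "m = k + Poly_Mapping.single i 1"
      by (intro poly_mapping_eqI) (auto simp: lookup_add lookup_minus lookup_single when_def)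
  qed (auto simp: lookup_add)
  show "Poly_Mapping.lookup (pd i (Poly_Mapping.single m c)) k
      = Poly_Mapping.lookup (Poly_Mapping.single (m - Poly_Mapping.single i 1)
          (of_nat (Poly_Mapping.lookup m i) * c)) k"
  proof (cases "m = k + Poly_Mapping.single i 1")
    case True
    then have "m - Poly_Mapping.single i 1 = k" and "Poly_Mapping.lookup m i = Poly_Mapping.lookup k i + 1"
      by (simp_all add: lookup_add)
    then show ?thesis using True by (simp add: pd.rep_eq)
  next
    case False
    then show ?thesis using * by (auto simp: pd.rep_eq lookup_single when_def)
  qed
qed

lemma cpoly_as_sum:
  "p = (\<Sum>m\<in>Poly_Mapping.keys p. Poly_Mapping.single m (Poly_Mapping.lookup p m))"
proof (rule poly_mapping_eqI)
  fix k
  show "Poly_Mapping.lookup p k = Poly_Mapping.lookup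
    (\<Sum>m\<in>Poly_Mapping.keys p. Poly_Mapping.single m (Poly_Mapping.lookup p m)) k"
    by (simp add: lookup_sum lookup_single when_def in_keys_iff)
qed

lemma pd_mult_single:
  "pd i (Poly_Mapping.single m a * Poly_Mapping.single k b)
     = pd i (Poly_Mapping.single m a) * Poly_Mapping.single k b
       + Poly_Mapping.single m a * pd i (Poly_Mapping.single k b)"
proof -
  let ?e = "Poly_Mapping.single i (1::nat)"
  have 1: "m - ?e + k = m + k - ?e" if "Poly_Mapping.lookup m i \<noteq> 0"
    using that by (intro poly_mapping_eqI) (auto simp: lookup_add lookup_minus lookup_single when_def)
  have 2: "m + (k - ?e) = m + k - ?e" if "Poly_Mapping.lookup k i \<noteq> 0"
    using that by (intro poly_mapping_eqI) (auto simp: lookup_add lookup_minus lookup_single when_def)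
  have p1: "pd i (Poly_Mapping.single m a) * Poly_Mapping.single k b
      = Poly_Mapping.single (m + k - ?e) (of_nat (Poly_Mapping.lookup m i) * (a * b))"
    by (cases "Poly_Mapping.lookup m i = 0") (simp_all add: pd_single mult_single 1 mult.assoc del: One_nat_def)
  have p2: "Poly_Mapping.single m a * pd i (Poly_Mapping.single k b)
      = Poly_Mapping.single (m + k - ?e) (of_nat (Poly_Mapping.lookup k i) * (a * b))"
    by (cases "Poly_Mapping.lookup k i = 0") (simp_all add: pd_single mult_single 2 mult.left_commute del: One_nat_def)
  show ?thesis
    unfolding p1 p2
    by (simp only: mult_single pd_single single_add [symmetric] lookup_add of_nat_add distrib_right)
qed

lemma pd_mult: "pd i (p * q) = pd i p * q + p * pd i q"
proof -
  let ?s = "\<lambda>p m. Poly_Mapping.single m (Poly_Mapping.lookup p m) :: 'a cpoly"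
  have "pd i ((\<Sum>m\<in>A. ?s p m) * (\<Sum>k\<in>B. ?s q k))
      = pd i (\<Sum>m\<in>A. ?s p m) * (\<Sum>k\<in>B. ?s q k) + (\<Sum>m\<in>A. ?s p m) * pd i (\<Sum>k\<in>B. ?s q k)" for A B
    by (simp add: sum_product pd_sum pd_mult_single sum.distrib)
  from this [of "Poly_Mapping.keys p" "Poly_Mapping.keys q"] show ?thesis
    by (simp only: cpoly_as_sum [symmetric])
qed

text \<open>The extension of the partial derivative to rational functions, by the quotient rule.\<close>
lift_definition pd_fract :: "'n :: linorder \<Rightarrow> 'n cpoly fract \<Rightarrow> 'n cpoly fract"
  is "\<lambda>i q. (pd i (fst q) * snd q - fst q * pd i (snd q), snd q * snd q)"
proof (unfold fractrel_iff fst_conv snd_conv, elim conjE, intro conjI)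
  fix i :: 'n and q r :: "'n cpoly \<times> 'n cpoly"
  define a b c d where [simp]: "a = fst q" "b = snd q" "c = fst r" "d = snd r"
  assume nz: "snd q \<noteq> 0" "snd r \<noteq> 0" and "fst q * snd r = fst r * snd q"
  then have eq: "a * d = c * b" by simp
  then have "pd i (a * d) = pd i (c * b)" by simp
  then have deq: "pd i a * d + a * pd i d = pd i c * b + c * pd i b" by (simp only: pd_mult)
  have "(pd i a * b - a * pd i b) * (d * d)
      = (pd i a * d + a * pd i d) * b * d - (a * d) * pd i d * b - (a * d) * pd i b * d"
    by (simp add: algebra_simps)
  also have "\<dots> = (pd i c * b + c * pd i b) * b * d - (c * b) * pd i d * b - (c * b) * pd i b * d"
    by (simp only: eq deq)
  also have "\<dots> = (pd i c * d - c * pd i d) * (b * b)"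
    by (simp add: algebra_simps)
  finally show "(pd i (fst q) * snd q - fst q * pd i (snd q)) * (snd r * snd r)
      = (pd i (fst r) * snd r - fst r * pd i (snd r)) * (snd q * snd q)" by simp
  show "snd q * snd q \<noteq> 0" "snd r * snd r \<noteq> 0" using nz by simp_all
qed

lemma pd_fract_Fract:
  "b \<noteq> 0 \<Longrightarrow> pd_fract i (Fract a b) = Fract (pd i a * b - a * pd i b) (b * b)"
  by (simp add: Fract.abs_eq pd_fract.abs_eq)

definition is_factorization :: "('n :: {finite, linorder}) cpoly \<Rightarrow> nat \<Rightarrow> (nat \<Rightarrow> 'n cpoly) \<Rightarrow> bool" where
  "is_factorization P s Pf \<longleftrightarrow> (\<forall>i\<in>{1..s}. irreducible (Pf i)) \<and> P = (\<Prod>i=1..s. Pf i)"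

definition reduced_poly :: "('n :: {finite, linorder}) cpoly \<Rightarrow> bool" where
  "reduced_poly P \<longleftrightarrow> P \<noteq> 0 \<and>
     (\<forall>s Pf. is_factorization P s Pf \<longrightarrow>
       (\<forall>i\<in>{1..s}. \<forall>j\<in>{1..s}. i \<noteq> j \<longrightarrow> \<not> (Pf i dvd Pf j \<and> Pf j dvd Pf i)))"

text \<open>The polynomial type has no \<open>gcd\<close> operation; greatest common divisors are described by their
  universal property, which determines them up to a unit, i.e. a nonzero constant.\<close>
definition is_gcd :: "'a :: comm_semiring_1 \<Rightarrow> 'a \<Rightarrow> 'a \<Rightarrow> bool" where
  "is_gcd d a b \<longleftrightarrow> d dvd a \<and> d dvd b \<and> (\<forall>c. c dvd a \<and> c dvd b \<longrightarrow> c dvd d)"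

section \<open>Genericity\<close>

definition zero_locus :: "('n :: finite) cpoly \<Rightarrow> ('n \<Rightarrow> complex) set" where
  "zero_locus P = {x. peval P x = 0}"

definition proj1 :: "('n :: {finite, linorder} \<Rightarrow> complex) \<Rightarrow> ('n \<Rightarrow> complex)" where
  "proj1 x = restrict x (UNIV - {var1})"

definition X1_generic :: "('n :: {finite, linorder}) cpoly \<Rightarrow> bool" where
  "X1_generic P \<longleftrightarrow> (\<forall>y. finite {x \<in> zero_locus P. proj1 x = y})"

section \<open>The spaces attached to a polynomial\<close>

definition F_space :: "('n :: {finite, linorder}) cpoly \<Rightarrow> ('n \<Rightarrow> 'n cpoly) set" where
  "F_space P = {A. (\<forall>i j. i < j \<longrightarrow> pd_fract i (Fract (A j) P) - pd_fract j (Fract (A i) P) = 0) \<and>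
             (\<forall>i. multideg_le (A i) ((\<lambda>k. int (deg_in k P))(i := int (deg_in i P) - 1)))}"

definition E_space :: "('n :: {finite, linorder}) cpoly \<Rightarrow> 'n cpoly set" where
  "E_space P = (\<lambda>A. A var1) ` F_space P"

definition cpoly_ring :: "'n cpoly ring" where
  "cpoly_ring = \<lparr>carrier = UNIV, mult = (*), one = 1, zero = 0, add = (+)\<rparr>"

definition Q_ring :: "'n cpoly \<Rightarrow> 'n cpoly set ring" where
  "Q_ring P = cpoly_ring Quot (PIdl\<^bsub>cpoly_ring\<^esub> P)"

definition cls :: "'n cpoly \<Rightarrow> 'n cpoly \<Rightarrow> 'n cpoly set" where
  "cls P f = PIdl\<^bsub>cpoly_ring\<^esub> P +>\<^bsub>cpoly_ring\<^esub> f"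

definition smultQ :: "'n cpoly \<Rightarrow> complex \<Rightarrow> 'n cpoly set \<Rightarrow> 'n cpoly set" where
  "smultQ P c x = cls P (Const c) \<otimes>\<^bsub>Q_ring P\<^esub> x"

definition E_bar :: "('n :: {finite, linorder}) cpoly \<Rightarrow> 'n cpoly set set" where
  "E_bar P = {cls P v | v. v \<in> E_space P}"

definition E_tilde :: "('n :: {finite, linorder}) cpoly \<Rightarrow> 'n cpoly set set" where
  "E_tilde P = {cls P (v * pd var1 P) | v. v \<in> E_space P}"

definition mulPX1 :: "('n :: {finite, linorder}) cpoly \<Rightarrow> 'n cpoly set \<Rightarrow> 'n cpoly set" where
  "mulPX1 P x = x \<otimes>\<^bsub>Q_ring P\<^esub> cls P (pd var1 P)"

text \<open>
  \<open>S_map P\<close> is the inverse of \<open>mulPX1 P : E_bar P \<rightarrow> E_tilde P\<close>. Its domain is \<open>E_tilde P\<close>; outside that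
  domain it takes the value \<open>{}\<close>, which is not a residue class.
\<close>
definition S_map :: "('n :: {finite, linorder}) cpoly \<Rightarrow> 'n cpoly set \<Rightarrow> 'n cpoly set" where
  "S_map P y = (if y \<in> E_tilde P then inv_into (E_bar P) (mulPX1 P) y else {})"

definition phi_map :: "'n cpoly \<Rightarrow> 'n cpoly \<Rightarrow> 'n cpoly set \<Rightarrow> 'n cpoly set" where
  "phi_map P v x = cls P v \<otimes>\<^bsub>Q_ring P\<^esub> x"

definition psi_map :: "('n :: {finite, linorder}) cpoly \<Rightarrow> 'n cpoly \<Rightarrow> 'n cpoly set \<Rightarrow> 'n cpoly set" where
  "psi_map P v = restrict (S_map P \<circ> phi_map P v) (E_bar P)"

text \<open>The eigenvalues of a linear endomorphism of the subspace \<open>W\<close> of \<open>Q_ring P\<close>.\<close>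
definition eigenvalues :: "'n cpoly \<Rightarrow> 'n cpoly set set \<Rightarrow> ('n cpoly set \<Rightarrow> 'n cpoly set) \<Rightarrow> complex set" where
  "eigenvalues P W T = {c. \<exists>x\<in>W. x \<noteq> \<zero>\<^bsub>Q_ring P\<^esub> \<and> T x = smultQ P c x}"

section \<open>Basic facts about the residue classes\<close>

lemma cring_cpoly_ring: "cring (cpoly_ring :: 'n cpoly ring)"
proof (intro cringI abelian_groupI comm_monoidI)
  fix x :: "'n cpoly"
  assume "x \<in> carrier cpoly_ring"
  have "- x + x = 0" by simp
  then show "\<exists>y\<in>carrier cpoly_ring. y \<oplus>\<^bsub>cpoly_ring\<^esub> x = \<zero>\<^bsub>cpoly_ring\<^esub>"
    by (auto simp: cpoly_ring_def intro!: exI [of _ "- x"])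
qed (simp_all add: cpoly_ring_def add.assoc add.commute mult.assoc mult.commute distrib_left distrib_right)

lemma ideal_PIdl: "ideal (PIdl\<^bsub>cpoly_ring\<^esub> P) (cpoly_ring :: 'n cpoly ring)"
  by (rule cring.cgenideal_ideal [OF cring_cpoly_ring]) (simp add: cpoly_ring_def)

lemma cls_eq: "cls P f = {g. P dvd g - f}"
proof -
  have "g \<in> cls P f \<longleftrightarrow> P dvd g - f" for g
  proof
    assume "g \<in> cls P f"
    then show "P dvd g - f"
      by (auto simp: cls_def cgenideal_def a_r_coset_def r_coset_def cpoly_ring_def)
  next
    assume "P dvd g - f"
    then obtain k where "g - f = P * k" by (rule dvdE)
    then have "g = k * P + f" by (simp add: algebra_simps)
    then show "g \<in> cls P f"
      by (auto simp: cls_def cgenideal_def a_r_coset_def r_coset_def cpoly_ring_def)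
  qed
  then show ?thesis by blast
qed

lemma cls_eq_iff: "cls P f = cls P g \<longleftrightarrow> P dvd f - g"
proof
  assume "cls P f = cls P g"
  moreover have "f \<in> cls P f" by (simp add: cls_eq)
  ultimately show "P dvd f - g" by (simp add: cls_eq)
next
  assume d: "P dvd f - g"
  have "P dvd h - f \<longleftrightarrow> P dvd h - g" for h
    using dvd_add_left_iff [OF d, of "h - f"] by simp
  then show "cls P f = cls P g" by (simp add: cls_eq)
qed

lemma cls_mult: "cls P f \<otimes>\<^bsub>Q_ring P\<^esub> cls P g = cls P (f * g)"
  using ideal.rcoset_mult_add [OF ideal_PIdl, of f g P]
  by (simp add: Q_ring_def FactRing_def cls_def cpoly_ring_def)

lemma zero_Q_ring: "\<zero>\<^bsub>Q_ring P\<^esub> = cls P 0"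
proof -
  have "PIdl\<^bsub>cpoly_ring\<^esub> P = {g. P dvd g}"
    unfolding cgenideal_def cpoly_ring_def dvd_def by (simp add: mult.commute [of P])
  then show ?thesis by (simp add: Q_ring_def FactRing_def cls_eq)
qed

lemma mulPX1_image: "mulPX1 P ` E_bar P = E_tilde P"
  by (simp add: mulPX1_def E_bar_def E_tilde_def setcompr_eq_image image_image cls_mult)

end

theory Submission
  imports Defs "HOL-Computational_Algebra.Fundamental_Theorem_Algebra"
begin

text \<open>
  If \<open>[u]\<close> is an eigenvector of \<open>\<psi>\<^sub>v\<close> for \<open>\<lambda>\<close>, then \<open>P\<close> divides \<open>u (v - \<lambda> P\<^sub>X)\<close> but not \<open>u\<close>, where
  \<open>P\<^sub>X\<close> is the derivative in the first variable. As \<open>P\<close> is a product of pairwise non-associate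
  primes, some \<open>P\<^sub>j\<close> divides \<open>v - \<lambda> P\<^sub>X\<close>. No \<open>P\<^sub>j\<close> divides \<open>P\<^sub>X\<close>: otherwise it divides its own
  derivative, hence is free of the first variable, and a zero of \<open>P\<^sub>j\<close> spans a whole line in the zero
  locus, against genericity. So one \<open>P\<^sub>j\<close> cannot serve two eigenvalues, and \<open>s\<close> eigenvalues exhaust
  the \<open>s\<close> factors.
\<close>

section \<open>Multivariate polynomials as univariate polynomials in one variable\<close>

text \<open>The coefficients stay in the full polynomial type, with the exponent of \<open>i\<close>
  set to zero, so variables can be peeled off one at a time without changing types.\<close>

definition upoly :: "'n \<Rightarrow> 'n cpoly \<Rightarrow> 'n cpoly poly" where
  "upoly i p = (\<Sum>m\<in>Poly_Mapping.keys p. monom (Poly_Mapping.single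
     (m - Poly_Mapping.single i (Poly_Mapping.lookup m i)) (Poly_Mapping.lookup p m)) (Poly_Mapping.lookup m i))"

text \<open>A term \<open>l\<close> of \<open>p\<close> contributes at \<open>k\<close> and
  \<open>m\<close> exactly when \<open>l\<close> is \<open>m\<close> plus \<open>k\<close> times the
  unit vector of \<open>i\<close>, with \<open>m\<close> free of \<open>i\<close>. Later identities
  are then checked coefficient by coefficient.\<close>

lemma lookup_coeff_upoly:
  "Poly_Mapping.lookup (coeff (upoly i p) k) m =
     (if Poly_Mapping.lookup m i = 0 then Poly_Mapping.lookup p (m + Poly_Mapping.single i k) else 0)"
proof -
  have *: "Poly_Mapping.lookup l i = k \<and> l - Poly_Mapping.single i (Poly_Mapping.lookup l i) = m \<longleftrightarrow>
      Poly_Mapping.lookup m i = 0 \<and> l = m + Poly_Mapping.single i k" for l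
  proof
    assume l: "Poly_Mapping.lookup l i = k \<and> l - Poly_Mapping.single i (Poly_Mapping.lookup l i) = m"
    then have "l = m + Poly_Mapping.single i k"
      by (intro poly_mapping_eqI) (auto simp: lookup_add lookup_minus lookup_single when_def)
    moreover from l have "Poly_Mapping.lookup m i = 0" by (auto simp: lookup_minus)
    ultimately show "Poly_Mapping.lookup m i = 0 \<and> l = m + Poly_Mapping.single i k" by simp
  qed (auto simp: lookup_add)
  have "Poly_Mapping.lookup (coeff (upoly i p) k) m =
      (\<Sum>l\<in>Poly_Mapping.keys p. if Poly_Mapping.lookup l i = k \<and>
         l - Poly_Mapping.single i (Poly_Mapping.lookup l i) = m then Poly_Mapping.lookup p l else 0)"
    unfolding upoly_def coeff_sum lookup_sum
    by (intro sum.cong) (auto simp: lookup_single when_def)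
  also have "\<dots> = (if Poly_Mapping.lookup m i = 0 then Poly_Mapping.lookup p (m + Poly_Mapping.single i k) else 0)"
    unfolding * by (cases "Poly_Mapping.lookup m i = 0") (simp_all add: sum.delta in_keys_iff)
  finally show ?thesis .
qed

lemma upoly_add: "upoly i (p + q) = upoly i p + upoly i q"
  by (intro poly_eqI poly_mapping_eqI) (simp add: lookup_coeff_upoly lookup_add)

lemma upoly_diff: "upoly i (p - q) = upoly i p - upoly i q"
  by (intro poly_eqI poly_mapping_eqI) (simp add: lookup_coeff_upoly lookup_minus)

lemma upoly_zero [simp]: "upoly i 0 = 0"
  by (simp add: upoly_def)

lemma upoly_sum: "upoly i (sum f A) = (\<Sum>a\<in>A. upoly i (f a))"
  by (induction A rule: infinite_finite_induct) (simp_all add: upoly_add)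

lemma upoly_single:
  "upoly i (Poly_Mapping.single m c) =
     monom (Poly_Mapping.single (m - Poly_Mapping.single i (Poly_Mapping.lookup m i)) c) (Poly_Mapping.lookup m i)"
  by (cases "c = 0") (simp_all add: upoly_def)

lemma upoly_mult_single:
  "upoly i (Poly_Mapping.single m a * Poly_Mapping.single k b) =
     upoly i (Poly_Mapping.single m a) * upoly i (Poly_Mapping.single k b)"
proof -
  have "m + k - Poly_Mapping.single i (Poly_Mapping.lookup m i + Poly_Mapping.lookup k i) =
      (m - Poly_Mapping.single i (Poly_Mapping.lookup m i)) + (k - Poly_Mapping.single i (Poly_Mapping.lookup k i))"
    by (intro poly_mapping_eqI) (auto simp: lookup_add lookup_minus lookup_single when_def)
  then show ?thesis by (simp add: mult_single upoly_single lookup_add mult_monom)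
qed

text \<open>Bilinearity reduces the claim to monomials. The expansion \<open>cpoly_as_sum\<close>
  mentions its own left side, so the sums are treated over free index sets and folded only at the
  end.\<close>

lemma upoly_mult: "upoly i (p * q) = upoly i p * upoly i q"
proof -
  let ?s = "\<lambda>p m. Poly_Mapping.single m (Poly_Mapping.lookup p m) :: 'a cpoly"
  have "upoly i ((\<Sum>m\<in>A. ?s p m) * (\<Sum>k\<in>B. ?s q k))
      = upoly i (\<Sum>m\<in>A. ?s p m) * upoly i (\<Sum>k\<in>B. ?s q k)" for A B
    by (simp add: sum_product upoly_sum upoly_mult_single)
  from this [of "Poly_Mapping.keys p" "Poly_Mapping.keys q"] show ?thesis
    by (simp only: cpoly_as_sum [symmetric])
qed

definition Var :: "'n \<Rightarrow> 'n cpoly" where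
  "Var i = Poly_Mapping.single (Poly_Mapping.single i 1) 1"

lemma Var_power: "Var i ^ k = Poly_Mapping.single (Poly_Mapping.single i k) 1"
  by (induction k) (simp_all add: Var_def mult_single single_add [symmetric] flip: single_one)

text \<open>Substituting the variable back undoes \<open>upoly i\<close>, which is therefore
  injective.\<close>

lemma poly_upoly_Var: "poly (upoly i p) (Var i) = p"
proof -
  have *: "m - Poly_Mapping.single i (Poly_Mapping.lookup m i) + Poly_Mapping.single i (Poly_Mapping.lookup m i) = m"
    for m :: "'a \<Rightarrow>\<^sub>0 nat"
    by (intro poly_mapping_eqI) (auto simp: lookup_add lookup_minus lookup_single when_def)
  have "poly (upoly i p) (Var i) =
      (\<Sum>m\<in>Poly_Mapping.keys p. Poly_Mapping.single m (Poly_Mapping.lookup p m))"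
    by (simp add: upoly_def poly_sum poly_monom Var_power mult_single *)
  then show ?thesis by (simp only: cpoly_as_sum [symmetric])
qed

lemma upoly_eq_0_iff [simp]: "upoly i p = 0 \<longleftrightarrow> p = 0"
  by (metis poly_upoly_Var poly_0 upoly_zero)

lemma upoly_const: "degree (upoly i p) = 0 \<Longrightarrow> upoly i p = [:p:]"
  by (metis degree_0_id poly_upoly_Var poly_const_conv)

text \<open>Degree 0 is the working form of independence from the variable \<open>i\<close>; it
  includes the zero polynomial.\<close>

lemma degree_upoly_eq_0_iff:
  "degree (upoly i p) = 0 \<longleftrightarrow> (\<forall>m. Poly_Mapping.lookup m i \<noteq> 0 \<longrightarrow> Poly_Mapping.lookup p m = 0)"
proof
  assume d: "degree (upoly i p) = 0"
  show "\<forall>m. Poly_Mapping.lookup m i \<noteq> 0 \<longrightarrow> Poly_Mapping.lookup p m = 0"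
  proof (intro allI impI)
    fix m :: "'a \<Rightarrow>\<^sub>0 nat" assume m: "Poly_Mapping.lookup m i \<noteq> 0"
    have "p = coeff (upoly i p) 0" using upoly_const [OF d] by simp
    moreover have "Poly_Mapping.lookup (coeff (upoly i p) 0) m = 0"
      using m by (simp add: lookup_coeff_upoly)
    ultimately show "Poly_Mapping.lookup p m = 0" by simp
  qed
next
  assume *: "\<forall>m. Poly_Mapping.lookup m i \<noteq> 0 \<longrightarrow> Poly_Mapping.lookup p m = 0"
  have "coeff (upoly i p) k = 0" if "k > 0" for k
    by (intro poly_mapping_eqI) (use * that in \<open>simp add: lookup_coeff_upoly lookup_add\<close>)
  then show "degree (upoly i p) = 0" by (simp add: degree_le flip: le_zero_eq)
qed

lemma degree_upoly_mult:
  fixes p q :: "'n :: linorder cpoly"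
  shows "p \<noteq> 0 \<Longrightarrow> q \<noteq> 0 \<Longrightarrow> degree (upoly i (p * q)) = degree (upoly i p) + degree (upoly i q)"
  by (simp add: upoly_mult degree_mult_eq)

lemma degree_upoly_coeff [simp]: "degree (upoly i (coeff (upoly i p) k)) = 0"
  by (simp add: degree_upoly_eq_0_iff lookup_coeff_upoly)

lemma upoly_Var_power: "upoly i (Var i ^ k) = monom 1 k"
  by (simp add: Var_power upoly_single flip: single_one)

text \<open>The subring generated over the constants by the variables in \<open>V\<close>, kept
  inside the full ring so that induction on \<open>V\<close> stays within one type.\<close>

definition polys_in :: "'n set \<Rightarrow> 'n cpoly set" where
  "polys_in V = {p. \<forall>i. i \<notin> V \<longrightarrow> degree (upoly i p) = 0}"

lemma polys_in_UNIV [simp]: "p \<in> polys_in UNIV"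
  by (simp add: polys_in_def)

lemma polys_in_mono: "V \<subseteq> W \<Longrightarrow> polys_in V \<subseteq> polys_in W"
  by (auto simp: polys_in_def)

lemma polys_in_add:
  assumes "p \<in> polys_in V" "q \<in> polys_in V"
  shows "p + q \<in> polys_in V"
  using assms degree_add_le [of "upoly i p" 0 "upoly i q" for i]
  by (simp add: polys_in_def upoly_add)

lemma polys_in_diff:
  assumes "p \<in> polys_in V" "q \<in> polys_in V"
  shows "p - q \<in> polys_in V"
  using assms degree_diff_le [of "upoly i p" 0 "upoly i q" for i]
  by (simp add: polys_in_def upoly_diff)

lemma polys_in_mult:
  assumes "p \<in> polys_in V" "q \<in> polys_in V"
  shows "p * q \<in> polys_in V"
proof -
  have "degree (upoly i (p * q)) = 0" if "i \<notin> V" for i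
    using that assms degree_mult_le [of "upoly i p" "upoly i q"] by (simp add: polys_in_def upoly_mult)
  then show ?thesis by (simp add: polys_in_def)
qed

lemmas polys_in_closed = polys_in_add polys_in_diff polys_in_mult

lemma polys_in_0 [simp]: "0 \<in> polys_in V"
  by (simp add: polys_in_def)

lemma polys_in_1 [simp]: "1 \<in> polys_in V"
  by (auto simp: polys_in_def degree_upoly_eq_0_iff lookup_one when_def)

lemma polys_in_Var_power: "i \<in> V \<Longrightarrow> Var i ^ k \<in> polys_in V"
  by (auto simp: polys_in_def degree_upoly_eq_0_iff Var_power lookup_single when_def)

text \<open>The degree in each variable is additive on nonzero products, so a factor cannot involve
  a variable that the product avoids.\<close>

lemma polys_in_dvd:
  fixes p q :: "'n :: linorder cpoly"
  assumes "p dvd q" "q \<in> polys_in V" "q \<noteq> 0"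
  shows "p \<in> polys_in V"
  using assms by (auto simp: polys_in_def degree_upoly_mult elim!: dvdE)

lemma polys_in_coeff_upoly:
  assumes "p \<in> polys_in (insert i V)"
  shows "coeff (upoly i p) k \<in> polys_in V"
proof -
  have "Poly_Mapping.lookup (coeff (upoly i p) k) m = 0" if "j \<notin> V" "Poly_Mapping.lookup m j \<noteq> 0" for j m
  proof (cases "j = i")
    case False
    with that assms have "degree (upoly j p) = 0" by (simp add: polys_in_def)
    with that show ?thesis by (simp add: degree_upoly_eq_0_iff lookup_coeff_upoly lookup_add)
  qed (use that in \<open>simp add: lookup_coeff_upoly\<close>)
  then show ?thesis by (simp add: polys_in_def degree_upoly_eq_0_iff)
qed

lemma polys_in_empty_eq_Const: "p \<in> polys_in {} \<longleftrightarrow> (\<exists>c. p = Const c)"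
proof
  assume p: "p \<in> polys_in {}"
  have "Poly_Mapping.lookup p m = 0" if "m \<noteq> 0" for m
  proof -
    from that obtain i where "Poly_Mapping.lookup m i \<noteq> 0"
      by (metis lookup_zero poly_mapping_eqI)
    with p show ?thesis by (auto simp: polys_in_def degree_upoly_eq_0_iff)
  qed
  then have "p = Const (Poly_Mapping.lookup p 0)"
    by (intro poly_mapping_eqI) (auto simp: Const_def lookup_single when_def)
  then show "\<exists>c. p = Const c" ..
next
  assume "\<exists>c. p = Const c"
  then show "p \<in> polys_in {}"
    by (auto simp: polys_in_def degree_upoly_eq_0_iff Const_def lookup_single when_def)
qed

lemma is_unit_cpoly_iff:
  fixes p :: "'n :: linorder cpoly"
  shows "p dvd 1 \<longleftrightarrow> p \<noteq> 0 \<and> p \<in> polys_in {}"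
proof
  assume "p dvd 1"
  then show "p \<noteq> 0 \<and> p \<in> polys_in {}" using polys_in_dvd [of p 1 "{}"] by auto
next
  assume *: "p \<noteq> 0 \<and> p \<in> polys_in {}"
  then obtain c where c: "p = Const c" by (auto simp: polys_in_empty_eq_Const)
  with * have "c \<noteq> 0" by (auto simp: Const_def)
  then have "1 = p * Const (inverse c)" by (simp add: c Const_def mult_single)
  then show "p dvd 1" by (rule dvdI)
qed

section \<open>Irreducible polynomials are prime\<close>

text \<open>Induction on the sum of the degrees in all variables: a nonunit cofactor has positive
  degree in some variable, so splitting it off lowers the sum.\<close>

lemma exists_irreducible_dvd:
  fixes p :: "'n :: {finite, linorder} cpoly"
  assumes "p \<noteq> 0" "\<not> p dvd 1"
  shows "\<exists>q. irreducible q \<and> q dvd p"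
  using assms
proof (induction "\<Sum>i\<in>UNIV. degree (upoly i p)" arbitrary: p rule: less_induct)
  case less
  show ?case
  proof (cases "irreducible p")
    case False
    with less.prems obtain a b where ab: "p = a * b" "\<not> a dvd 1" "\<not> b dvd 1"
      by (auto simp: irreducible_def)
    with less.prems have nz: "a \<noteq> 0" "b \<noteq> 0" by auto
    with ab obtain i where "degree (upoly i b) \<noteq> 0" by (auto simp: is_unit_cpoly_iff polys_in_def)
    then have "(\<Sum>i\<in>UNIV. degree (upoly i b)) > 0" by (auto simp: sum_eq_0_iff intro!: gr0I)
    then have "(\<Sum>i\<in>UNIV. degree (upoly i a)) < (\<Sum>i\<in>UNIV. degree (upoly i p))"
      by (simp add: ab(1) degree_upoly_mult nz sum.distrib)
    from less.hyps [OF this nz(1) ab(2)] show ?thesis using ab(1) by auto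
  qed auto
qed

text \<open>Existence of factorizations in the form of an induction rule, by stripping one
  irreducible factor at a time.\<close>

lemma nonzero_cpoly_induct [consumes 1, case_names unit irreducible]:
  fixes c :: "'n :: {finite, linorder} cpoly"
  assumes "c \<noteq> 0"
    and unit: "\<And>c. c dvd 1 \<Longrightarrow> Q c"
    and irreducible: "\<And>p c. irreducible p \<Longrightarrow> c \<noteq> 0 \<Longrightarrow> Q c \<Longrightarrow> Q (p * c)"
  shows "Q c"
  using \<open>c \<noteq> 0\<close>
proof (induction "\<Sum>i\<in>UNIV. degree (upoly i c)" arbitrary: c rule: less_induct)
  case less
  show ?case
  proof (cases "c dvd 1")
    case False
    with less.prems obtain p where p: "irreducible p" "p dvd c"
      using exists_irreducible_dvd by blast
    then obtain c' where c: "c = p * c'" by blast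
    with less.prems have nz: "p \<noteq> 0" "c' \<noteq> 0" by auto
    with p obtain i where "degree (upoly i p) \<noteq> 0"
      by (auto simp: irreducible_def is_unit_cpoly_iff polys_in_def)
    then have "(\<Sum>i\<in>UNIV. degree (upoly i p)) > 0" by (auto simp: sum_eq_0_iff intro!: gr0I)
    then have "(\<Sum>i\<in>UNIV. degree (upoly i c')) < (\<Sum>i\<in>UNIV. degree (upoly i c))"
      by (simp add: c degree_upoly_mult nz sum.distrib)
    from less.hyps [OF this nz(2)] show ?thesis using c nz p by (auto intro: irreducible)
  qed (rule unit)
qed

text \<open>Irreducibility and divisibility refer to the full ring. Two variable sets are needed
  because the induction enlarges first the set for the factors \<open>g\<close>, \<open>h\<close>
  and then the set for the divisor \<open>p\<close>.\<close>

definition primes_in :: "'n :: {finite, linorder} set \<Rightarrow> 'n set \<Rightarrow> bool" where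
  "primes_in V W \<longleftrightarrow> (\<forall>p\<in>polys_in V. irreducible p \<longrightarrow>
     (\<forall>g\<in>polys_in W. \<forall>h\<in>polys_in W. p dvd g * h \<longrightarrow> p dvd g \<or> p dvd h))"

lemma primes_inD:
  "primes_in V W \<Longrightarrow> irreducible p \<Longrightarrow> p \<in> polys_in V \<Longrightarrow> g \<in> polys_in W \<Longrightarrow> h \<in> polys_in W \<Longrightarrow>
     p dvd g * h \<Longrightarrow> p dvd g \<or> p dvd h"
  unfolding primes_in_def by blast

text \<open>The divisor \<open>p\<close> is free of the variable \<open>x\<close>, so it divides the leading \<open>x\<close>-coefficient of
  one of the factors; that leading term can then be removed.\<close>
lemma primes_in_insert_right:
  assumes V: "primes_in V V" and x: "x \<notin> V"
  shows "primes_in V (insert x V)"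
  unfolding primes_in_def
proof (intro ballI impI)
  fix p g h :: "'a cpoly"
  assume p: "p \<in> polys_in V" "irreducible p"
    and "g \<in> polys_in (insert x V)" "h \<in> polys_in (insert x V)" "p dvd g * h"
  then show "p dvd g \<or> p dvd h"
  proof (induction "degree (upoly x g) + degree (upoly x h)" arbitrary: g h rule: less_induct)
    case less
    have px: "upoly x p = [:p:]" using p(1) x by (intro upoly_const) (simp add: polys_in_def)
    define lc where "lc = (\<lambda>g. lead_coeff (upoly x g))"
    define red where "red = (\<lambda>g. g - lc g * Var x ^ degree (upoly x g))"
    have lcV: "lc f \<in> polys_in V" if "f \<in> polys_in (insert x V)" for f
      using that by (simp add: lc_def polys_in_coeff_upoly)
    have redV: "red f \<in> polys_in (insert x V)" if "f \<in> polys_in (insert x V)" for f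
    proof -
      have "lc f \<in> polys_in (insert x V)"
        using lcV [OF that] polys_in_mono [of V "insert x V"] by blast
      with that show ?thesis
        unfolding red_def by (intro polys_in_diff polys_in_mult polys_in_Var_power) auto
    qed
    have up_red: "upoly x (red f) = upoly x f - monom (lc f) (degree (upoly x f))" for f
      by (simp add: red_def upoly_diff upoly_mult upoly_Var_power lc_def upoly_const smult_monom)
    have red: "red f = 0 \<or> degree (upoly x (red f)) < degree (upoly x f)" for f
    proof -
      have "degree (upoly x (red f)) \<le> degree (upoly x f)"
        unfolding up_red by (intro degree_diff_le degree_monom_le order_refl)
      moreover have "coeff (upoly x (red f)) (degree (upoly x f)) = 0"
        by (simp add: up_red lc_def)
      ultimately have "upoly x (red f) = 0 \<or> degree (upoly x (red f)) < degree (upoly x f)"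
        by (rule eq_zero_or_degree_less)
      then show ?thesis by simp
    qed
    have lift: "p dvd f" if "p dvd lc f" "p dvd red f" for f
    proof -
      have "f = red f + lc f * Var x ^ degree (upoly x f)" by (simp add: red_def)
      with that show ?thesis by (metis dvd_add dvd_mult2)
    qed
    obtain t where t: "g * h = p * t" using less.prems by blast
    \<comment> \<open>Leading coefficients multiply, and \<open>p\<close> is a constant in
      \<open>x\<close>, so \<open>p\<close> divides the leading coefficient of
      \<open>p * t\<close>.\<close>
    have "lc g * lc h = lead_coeff (upoly x (g * h))"
      by (simp add: lc_def upoly_mult lead_coeff_mult)
    also have "\<dots> = p * lead_coeff (upoly x t)" by (simp add: t upoly_mult px)
    finally have "p dvd lc g * lc h" by simp
    then have "p dvd lc g \<or> p dvd lc h"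
      using less.prems by (intro primes_inD [OF V p(2,1)] lcV)
    then show ?case
    proof
      assume d: "p dvd lc g"
      have "red g * h = g * h - lc g * Var x ^ degree (upoly x g) * h"
        by (simp add: red_def algebra_simps)
      then have dvd: "p dvd red g * h" using d less.prems by simp
      \<comment> \<open>If \<open>g\<close> has \<open>x\<close>-degree 0, then \<open>red g\<close>
        vanishes and no degree drops; hence the separate case.\<close>
      consider "red g = 0" | "degree (upoly x (red g)) < degree (upoly x g)" using red by blast
      then show ?thesis
      proof cases
        case 2
        then show ?thesis using less.hyps [of "red g" h] less.prems dvd redV lift [OF d] by auto
      qed (use lift [OF d] in simp)
    next
      assume d: "p dvd lc h"
      have "g * red h = g * h - g * lc h * Var x ^ degree (upoly x h)"
        by (simp add: red_def algebra_simps)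
      then have dvd: "p dvd g * red h" using d less.prems by simp
      consider "red h = 0" | "degree (upoly x (red h)) < degree (upoly x h)" using red by blast
      then show ?thesis
      proof cases
        case 2
        then show ?thesis using less.hyps [of g "red h"] less.prems dvd redV lift [OF d] by auto
      qed (use lift [OF d] in simp)
    qed
  qed
qed

lemma irreducible_dvd_irreducible:
  fixes p q :: "'a :: comm_semiring_1"
  assumes "irreducible p" "irreducible q" "p dvd q"
  shows "q dvd p"
proof -
  from \<open>p dvd q\<close> obtain k where k: "q = p * k" by blast
  with assms have "k dvd 1" by (auto simp: irreducible_def)
  then obtain u where u: "1 = k * u" by blast
  have "q * u = p * (k * u)" by (simp add: k mult.assoc)
  then have "p = q * u" by (simp flip: u)
  then show ?thesis by (rule dvdI)
qed

text \<open>Irreducible factors \<open>p\<close> of \<open>c\<close> are cancelled one by one. Such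
  a \<open>p\<close> cannot divide \<open>f\<close>, as \<open>f\<close> would then divide
  \<open>p\<close> and lie in \<open>polys_in V\<close>; so \<open>p\<close> divides the cofactor
  \<open>t\<close>.\<close>

lemma cancel_coefficient:
  fixes f :: "'n :: {finite, linorder} cpoly"
  assumes VW: "primes_in V W" and f: "irreducible f" "f \<in> polys_in W" "f \<notin> polys_in V"
    and c: "c \<noteq> 0" "c \<in> polys_in V" and h: "h \<in> polys_in W" "h \<noteq> 0" and "V \<subseteq> W"
    and "f dvd c * h"
  shows "f dvd h"
  using c \<open>f dvd c * h\<close>
proof (induction rule: nonzero_cpoly_induct)
  case (unit c)
  then obtain c' where "1 = c * c'" by blast
  then have "h = c' * (c * h)" by (metis mult.assoc mult.commute mult_1)
  with unit show ?case by (metis dvd_mult)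
next
  case (irreducible p c)
  from irreducible have "p * c \<noteq> 0" by auto
  with irreducible have V: "p \<in> polys_in V" "c \<in> polys_in V"
    by (meson dvd_triv_left dvd_triv_right polys_in_dvd)+
  obtain t where t: "p * c * h = f * t" using irreducible by blast
  have "p * c * h \<in> polys_in W" using irreducible h \<open>V \<subseteq> W\<close> polys_in_mono
    by (blast intro: polys_in_mult)
  then have "t \<in> polys_in W"
    using polys_in_dvd [of t "f * t" W] t \<open>p * c \<noteq> 0\<close> h by (metis dvd_triv_right mult_eq_0_iff)
  moreover have "p dvd f * t" by (metis t dvd_triv_left mult.assoc)
  ultimately have "p dvd f \<or> p dvd t"
    using primes_inD [OF VW] irreducible V f by blast
  moreover have "\<not> p dvd f"
  proof
    assume "p dvd f"
    then have "f dvd p" using irreducible f irreducible_dvd_irreducible by blast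
    then show False using polys_in_dvd V f irreducible by (metis irreducible_def)
  qed
  ultimately obtain t' where "t = p * t'" by blast
  with t have "p * (c * h) = p * (f * t')" by (simp add: algebra_simps)
  moreover have "p \<noteq> 0" using \<open>p * c \<noteq> 0\<close> by auto
  ultimately have "c * h = f * t'" by simp
  then show ?case using irreducible V by auto
qed

text \<open>Each irreducible factor of \<open>c\<close> divides \<open>q\<close> or \<open>d\<close>
  and is cancelled there; those taken from \<open>d\<close> accumulate in \<open>c1\<close>. This
  replaces passing to the primitive part of \<open>d\<close>.\<close>

lemma split_coefficient:
  fixes f :: "'n :: {finite, linorder} cpoly"
  assumes VW: "primes_in V W" and "V \<subseteq> W"
    and c: "c \<noteq> 0" "c \<in> polys_in V" and "q \<in> polys_in W" "d \<in> polys_in W"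
    and "c * f = q * d"
  shows "\<exists>c1 d' q'. c1 \<in> polys_in V \<and> d = c1 * d' \<and> f = q' * d'"
  using c assms(5-)
proof (induction arbitrary: q d rule: nonzero_cpoly_induct)
  case (unit c)
  then obtain c' where "1 = c * c'" by blast
  then have "f = c' * (c * f)" by (metis mult.assoc mult.commute mult_1)
  then have "f = (c' * q) * d" using unit by (simp add: mult.assoc)
  then show ?case by (metis polys_in_1 mult_1)
next
  case (irreducible p c)
  from irreducible have "p * c \<noteq> 0" by auto
  with irreducible have V: "p \<in> polys_in V" "c \<in> polys_in V"
    by (meson dvd_triv_left dvd_triv_right polys_in_dvd)+
  have nz: "p \<noteq> 0" using irreducible by auto
  have "p dvd q * d" by (metis irreducible.prems(4) dvd_triv_left mult.assoc)
  then have "p dvd q \<or> p dvd d"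
    using primes_inD [OF VW] irreducible V by blast
  then show ?case
  proof
    assume "p dvd q"
    then obtain q1 where q1: "q = p * q1" by blast
    with irreducible.prems have "p * (c * f) = p * (q1 * d)" by (simp add: algebra_simps)
    with nz have eq: "c * f = q1 * d" by simp
    have "q1 \<in> polys_in W"
      by (cases "q = 0") (use irreducible.prems nz q1 polys_in_dvd [of q1 q] in auto)
    with irreducible.IH [of q1 d] V irreducible.prems eq show ?thesis by auto
  next
    assume "p dvd d"
    then obtain d1 where d1: "d = p * d1" by blast
    with irreducible.prems have "p * (c * f) = p * (q * d1)" by (simp add: algebra_simps)
    with nz have eq: "c * f = q * d1" by simp
    have "d1 \<in> polys_in W"
      by (cases "d = 0") (use irreducible.prems nz d1 polys_in_dvd [of d1 d] in auto)
    with irreducible.IH [of q d1] V irreducible.prems eq obtain c1 d' q'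
      where "c1 \<in> polys_in V" "d1 = c1 * d'" "f = q' * d'" by auto
    then have "p * c1 \<in> polys_in V \<and> d = (p * c1) * d' \<and> f = q' * d'"
      using V d1 by (auto intro: polys_in_mult simp: mult.assoc)
    then show ?thesis by blast
  qed
qed

text \<open>Division with remainder where the leading coefficient of \<open>d\<close> is multiplied
  in rather than inverted. Remainders stay in the ideal \<open>I\<close>, so minimality of
  \<open>d\<close> forces the process to end at 0.\<close>

lemma pseudo_division_min:
  fixes I :: "'n :: {finite, linorder} cpoly set"
  assumes x: "x \<notin> V" and IW: "I \<subseteq> polys_in (insert x V)"
    and diff: "\<And>p q. p \<in> I \<Longrightarrow> q \<in> I \<Longrightarrow> p - q \<in> I"
    and mult: "\<And>p q. p \<in> polys_in (insert x V) \<Longrightarrow> q \<in> I \<Longrightarrow> p * q \<in> I"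
    and d: "d \<in> I" "d \<noteq> 0" "\<And>e. e \<in> I \<Longrightarrow> e \<noteq> 0 \<Longrightarrow> degree (upoly x d) \<le> degree (upoly x e)"
    and "g \<in> I"
  shows "\<exists>c q. c \<in> polys_in V \<and> c \<noteq> 0 \<and> q \<in> polys_in (insert x V) \<and> c * g = q * d"
  using \<open>g \<in> I\<close>
proof (induction "degree (upoly x g)" arbitrary: g rule: less_induct)
  case less
  show ?case
  proof (cases "g = 0")
    case True
    then show ?thesis by (intro exI [of _ 1] exI [of _ 0]) auto
  next
    case False
    define a b m n where "a = lead_coeff (upoly x d)" "b = lead_coeff (upoly x g)"
      "m = degree (upoly x g)" "n = degree (upoly x d)"
    note defs = this
    \<comment> \<open>Minimality makes the truncated subtraction \<open>m - n\<close> exact.\<close>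
    have nm: "n \<le> m" using d(3) [OF less.prems False] by (simp add: defs)
    have aV: "a \<in> polys_in V" "b \<in> polys_in V"
      using IW d(1) less.prems by (auto simp: defs intro!: polys_in_coeff_upoly)
    then have aW: "a \<in> polys_in (insert x V)" "b \<in> polys_in (insert x V)"
      using polys_in_mono [of V "insert x V"] by auto
    have bxW: "b * Var x ^ (m - n) \<in> polys_in (insert x V)"
      using aW by (intro polys_in_mult polys_in_Var_power) auto
    have a0: "a \<noteq> 0" using d by (simp add: defs)
    \<comment> \<open>The two leading terms in \<open>x\<close> cancel, both having coefficient
      \<open>a * b\<close> in degree \<open>m\<close>.\<close>
    define g' where "g' = a * g - (b * Var x ^ (m - n)) * d"
    have g'I: "g' \<in> I" unfolding g'_def using aW bxW d less.prems by (intro diff mult)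
    have up: "upoly x g' = smult a (upoly x g) - monom b (m - n) * upoly x d"
      by (simp add: g'_def upoly_diff upoly_mult upoly_Var_power smult_monom)
         (simp add: defs upoly_const smult_monom)
    have "degree (upoly x g') \<le> m"
      unfolding up
    proof (rule degree_diff_le)
      show "degree (smult a (upoly x g)) \<le> m" by (simp add: defs)
      show "degree (monom b (m - n) * upoly x d) \<le> m"
        using degree_mult_le [of "monom b (m - n)" "upoly x d"] degree_monom_le [of b "m - n"] nm
        by (simp add: defs)
    qed
    moreover have "coeff (upoly x g') m = 0"
      using nm by (simp add: up coeff_monom_mult) (simp add: defs mult.commute)
    ultimately have "upoly x g' = 0 \<or> degree (upoly x g') < m"
      by (rule eq_zero_or_degree_less)
    then have "\<exists>c q. c \<in> polys_in V \<and> c \<noteq> 0 \<and> q \<in> polys_in (insert x V) \<and> c * g' = q * d"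
    proof
      assume "upoly x g' = 0"
      then have "g' = 0" by simp
      then show ?thesis by (intro exI [of _ 1] exI [of _ 0]) auto
    next
      assume "degree (upoly x g') < m"
      then show ?thesis using less.hyps [of g'] g'I by (simp add: defs)
    qed
    then obtain c q where cq: "c \<in> polys_in V" "c \<noteq> 0" "q \<in> polys_in (insert x V)" "c * g' = q * d"
      by blast
    have "(c * a) * g = (q + c * (b * Var x ^ (m - n))) * d"
      using cq(4) by (simp add: g'_def algebra_simps)
    moreover have "c \<in> polys_in (insert x V)" using cq(1) polys_in_mono [of V "insert x V"] by auto
    ultimately show ?thesis using cq a0 aV bxW
      by (intro exI [of _ "c * a"] exI [of _ "q + c * (b * Var x ^ (m - n))"])
        (auto intro: polys_in_closed)
  qed
qed

text \<open>Gauss's lemma without quotient fields: an element of least \<open>x\<close>-degree in the ideal \<open>(f, g)\<close>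
  plays the role of the gcd over the field of fractions of the coefficient ring.\<close>
lemma primes_in_insert:
  assumes V: "primes_in V V" and x: "x \<notin> V"
  shows "primes_in (insert x V) (insert x V)"
  unfolding primes_in_def
proof (intro ballI impI)
  let ?W = "insert x V"
  fix f g h :: "'a cpoly"
  assume f: "f \<in> polys_in ?W" "irreducible f" and gh: "g \<in> polys_in ?W" "h \<in> polys_in ?W"
    and dvd: "f dvd g * h"
  have VW: "primes_in V ?W" using V x by (rule primes_in_insert_right)
  have sub: "V \<subseteq> ?W" by auto
  show "f dvd g \<or> f dvd h"
  proof (cases "f \<in> polys_in V \<or> g = 0 \<or> h = 0")
    case True
    then show ?thesis using primes_inD [OF VW f(2)] gh dvd by auto
  next
    case False
    then have fV: "f \<notin> polys_in V" and nz: "g \<noteq> 0" "h \<noteq> 0" by auto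
    have f0: "f \<noteq> 0" using f by auto
    define I where "I = {a * f + b * g | a b. a \<in> polys_in ?W \<and> b \<in> polys_in ?W}"
    have I_W: "I \<subseteq> polys_in ?W" using f gh by (auto simp: I_def intro: polys_in_closed)
    have I_diff: "p - q \<in> I" if "p \<in> I" "q \<in> I" for p q
    proof -
      from that obtain a b a' b' where *: "p = a * f + b * g" "q = a' * f + b' * g"
        "a \<in> polys_in ?W" "b \<in> polys_in ?W" "a' \<in> polys_in ?W" "b' \<in> polys_in ?W"
        by (auto simp: I_def)
      then have "p - q = (a - a') * f + (b - b') * g" by (simp add: algebra_simps)
      then show ?thesis using * unfolding I_def by (blast intro: polys_in_diff)
    qed
    have I_mult: "p * q \<in> I" if "p \<in> polys_in ?W" "q \<in> I" for p q
    proof -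
      from that obtain a b where *: "q = a * f + b * g" "a \<in> polys_in ?W" "b \<in> polys_in ?W"
        by (auto simp: I_def)
      then have "p * q = (p * a) * f + (p * b) * g" by (simp add: algebra_simps)
      then show ?thesis using * that unfolding I_def by (blast intro: polys_in_mult)
    qed
    have "f = 1 * f + 0 * g" "g = 0 * f + 1 * g" by simp_all
    then have fI: "f \<in> I" and gI: "g \<in> I"
      unfolding I_def using polys_in_0 polys_in_1 by blast+
    obtain d where d: "d \<in> I" "d \<noteq> 0" "\<And>e. e \<in> I \<Longrightarrow> e \<noteq> 0 \<Longrightarrow> degree (upoly x d) \<le> degree (upoly x e)"
      using ex_has_least_nat [of "\<lambda>e. e \<in> I \<and> e \<noteq> 0" f "\<lambda>e. degree (upoly x e)"] fI f0 by blast
    have div: "\<exists>c q. c \<in> polys_in V \<and> c \<noteq> 0 \<and> q \<in> polys_in ?W \<and> c * e = q * d" if "e \<in> I" for e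
      by (rule pseudo_division_min [of x V I d]) (use x I_W I_diff I_mult d that in blast)+
    from div [OF fI] obtain c q where c: "c \<in> polys_in V" "c \<noteq> 0" "q \<in> polys_in ?W" "c * f = q * d"
      by blast
    \<comment> \<open>Removing a factor free of \<open>x\<close> from \<open>d\<close> leaves
      \<open>d'\<close>, a genuine divisor of the irreducible \<open>f\<close>: an associate of
      \<open>f\<close> or a unit.\<close>
    from split_coefficient [OF VW sub c(2,1,3) _ c(4)] d(1) I_W obtain c1 d' q'
      where s: "c1 \<in> polys_in V" "d = c1 * d'" "f = q' * d'" by blast
    then have c1: "c1 \<noteq> 0" using d by auto
    from s f(2) have "q' dvd 1 \<or> d' dvd 1" by (auto simp: irreducible_def)
    then show ?thesis
    proof
      \<comment> \<open>Here \<open>f\<close> divides \<open>d\<close>, hence a multiple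
        \<open>c2 * g\<close> with \<open>c2\<close> free of \<open>x\<close>, and \<open>c2\<close>
        can be cancelled.\<close>
      assume "q' dvd 1"
      then obtain u where "1 = q' * u" by blast
      then have "d' = u * f" by (metis s(3) mult.assoc mult.commute mult_1)
      then have "f dvd d" by (metis s(2) dvd_mult dvd_triv_right)
      from div [OF gI] obtain c2 q2 where c2: "c2 \<in> polys_in V" "c2 \<noteq> 0" "c2 * g = q2 * d"
        by blast
      have "f dvd c2 * g" using c2 \<open>f dvd d\<close> by simp
      then show ?thesis
        using cancel_coefficient [OF VW f(2,1) fV c2(2,1) gh(1) nz(1) sub] by blast
    next
      \<comment> \<open>Here \<open>c1\<close> itself is a combination of \<open>f\<close> and
        \<open>g\<close>; multiplying it by \<open>h\<close> gives a multiple of \<open>f\<close>,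
        and \<open>c1\<close> can be cancelled.\<close>
      assume "d' dvd 1"
      then obtain u where u: "1 = d' * u" by blast
      have "d * u = c1 * (d' * u)" by (simp add: s(2) mult.assoc)
      then have "c1 = d * u" by (simp flip: u)
      moreover obtain a b where "d = a * f + b * g" using d(1) by (auto simp: I_def)
      ultimately have "c1 * h = f * (a * u * h) + (g * h) * (b * u)" by (simp add: algebra_simps)
      then have "f dvd c1 * h" using dvd by simp
      then show ?thesis
        using cancel_coefficient [OF VW f(2,1) fV c1 s(1) gh(2) nz(2) sub] by blast
    qed
  qed
qed

text \<open>Variables are added one at a time, starting from the constants, among which nothing is
  irreducible.\<close>

lemma primes_in_self: "primes_in V V"
  using finite [of V]
proof induction
  case empty
  then show ?case by (auto simp: primes_in_def irreducible_def is_unit_cpoly_iff)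
qed (rule primes_in_insert)

theorem irreducible_imp_prime_elem_cpoly:
  fixes p :: "'n :: {finite, linorder} cpoly"
  assumes "irreducible p"
  shows "prime_elem p"
  unfolding prime_elem_def
proof (intro conjI allI impI)
  show "p \<noteq> 0" "\<not> p dvd 1" using assms by (auto simp: irreducible_def)
qed (use primes_inD [OF primes_in_self [of UNIV] assms] in simp)

section \<open>Zeros and nonzeros of polynomials\<close>

lemma peval_eq_sum:
  assumes "finite A" "Poly_Mapping.keys p \<subseteq> A"
  shows "peval p x = (\<Sum>m\<in>A. Poly_Mapping.lookup p m * (\<Prod>i\<in>UNIV. x i ^ Poly_Mapping.lookup m i))"
  unfolding peval_def using assms by (intro sum.mono_neutral_left) (auto simp: in_keys_iff)

lemma peval_zero [simp]: "peval 0 x = 0"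
  by (simp add: peval_def)

lemma peval_add: "peval (p + q) x = peval p x + peval q x"
proof -
  let ?A = "Poly_Mapping.keys p \<union> Poly_Mapping.keys q"
  have "Poly_Mapping.keys (p + q) \<subseteq> ?A" by (rule keys_add)
  then show ?thesis
    by (simp add: peval_eq_sum [of ?A] lookup_add distrib_right sum.distrib)
qed

lemma peval_sum: "peval (sum f A) x = (\<Sum>a\<in>A. peval (f a) x)"
  by (induction A rule: infinite_finite_induct) (simp_all add: peval_add)

lemma peval_single: "peval (Poly_Mapping.single m c) x = c * (\<Prod>i\<in>UNIV. x i ^ Poly_Mapping.lookup m i)"
  by (cases "c = 0") (simp_all add: peval_def)

lemma peval_mult: "peval (p * q) x = peval p x * peval q x"
proof -
  let ?s = "\<lambda>p m. Poly_Mapping.single m (Poly_Mapping.lookup p m) :: 'a cpoly"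
  have "peval ((\<Sum>m\<in>A. ?s p m) * (\<Sum>k\<in>B. ?s q k)) x = peval (\<Sum>m\<in>A. ?s p m) x * peval (\<Sum>k\<in>B. ?s q k) x"
    for A B
    by (simp add: sum_product peval_sum mult_single peval_single lookup_add power_add prod.distrib algebra_simps)
  from this [of "Poly_Mapping.keys p" "Poly_Mapping.keys q"] show ?thesis
    by (simp only: cpoly_as_sum [symmetric])
qed

text \<open>The coefficients of \<open>upoly i p\<close> are free of the variable \<open>i\<close>,
  so they may be evaluated at \<open>y\<close> whatever \<open>t\<close> is.\<close>

lemma peval_fun_upd: "peval p (y(i := t)) = poly (map_poly (\<lambda>a. peval a y) (upoly i p)) t"
proof -
  have single: "peval (Poly_Mapping.single m c) (y(i := t)) =
      poly (map_poly (\<lambda>a. peval a y) (upoly i (Poly_Mapping.single m c))) t" for m c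
  proof -
    let ?m = "m - Poly_Mapping.single i (Poly_Mapping.lookup m i)"
    have "(\<Prod>j\<in>UNIV. (y(i := t)) j ^ Poly_Mapping.lookup m j) =
        t ^ Poly_Mapping.lookup m i * (\<Prod>j\<in>UNIV - {i}. y j ^ Poly_Mapping.lookup m j)"
      by (subst prod.remove [of _ i]) (auto intro!: prod.cong)
    moreover have "(\<Prod>j\<in>UNIV. y j ^ Poly_Mapping.lookup ?m j) =
        (\<Prod>j\<in>UNIV - {i}. y j ^ Poly_Mapping.lookup m j)"
      by (subst prod.remove [of _ i]) (auto intro!: prod.cong simp: lookup_minus lookup_single when_def)
    ultimately show ?thesis
      by (simp add: peval_single upoly_single map_poly_monom poly_monom)
  qed
  have add: "map_poly (\<lambda>a. peval a y) (p + q) = map_poly (\<lambda>a. peval a y) p + map_poly (\<lambda>a. peval a y) q"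
    for p q :: "'a cpoly poly"
    by (rule poly_eqI) (simp add: coeff_map_poly peval_add)
  have "peval (\<Sum>m\<in>A. Poly_Mapping.single m (Poly_Mapping.lookup p m)) (y(i := t)) =
      poly (map_poly (\<lambda>a. peval a y) (upoly i (\<Sum>m\<in>A. Poly_Mapping.single m (Poly_Mapping.lookup p m)))) t" for A
    by (induction A rule: infinite_finite_induct) (simp_all add: peval_add upoly_add add single del: fun_upd_apply)
  from this [of "Poly_Mapping.keys p"] show ?thesis by (simp only: cpoly_as_sum [symmetric])
qed

text \<open>Induction on the variables: where the leading coefficient is nonzero, a nonzero
  univariate polynomial remains, and it has finitely many roots.\<close>

lemma exists_peval_nonzero:
  fixes p :: "'n :: finite cpoly"
  assumes "p \<noteq> 0"
  shows "\<exists>y. peval p y \<noteq> 0"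
proof -
  have "p \<in> polys_in V \<Longrightarrow> p \<noteq> 0 \<Longrightarrow> \<exists>y. peval p y \<noteq> 0" for V and p :: "'n cpoly"
    using finite [of V]
  proof (induction V arbitrary: p)
    case empty
    then obtain c where "p = Const c" by (auto simp: polys_in_empty_eq_Const)
    with empty show ?case by (auto simp: Const_def peval_single)
  next
    case (insert x V)
    let ?q = "upoly x p"
    have "lead_coeff ?q \<in> polys_in V" "lead_coeff ?q \<noteq> 0"
      using insert.prems by (auto intro: polys_in_coeff_upoly)
    then obtain y where y: "peval (lead_coeff ?q) y \<noteq> 0" using insert.IH by blast
    define r where "r = map_poly (\<lambda>a. peval a y) ?q"
    have "coeff r (degree ?q) \<noteq> 0" using y by (simp add: r_def coeff_map_poly)
    then have "r \<noteq> 0" by auto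
    then have "finite {t. poly r t = 0}" by (rule poly_roots_finite)
    then obtain t where "poly r t \<noteq> 0"
      using ex_new_if_finite [OF infinite_UNIV_char_0] by blast
    then have "peval p (y(x := t)) \<noteq> 0" by (simp add: peval_fun_upd r_def)
    then show ?case by blast
  qed
  from this [of p UNIV] assms show ?thesis by simp
qed

text \<open>Specializing the other variables where the leading coefficient is nonzero keeps the
  degree positive, so the fundamental theorem of algebra applies.\<close>

lemma exists_peval_zero:
  fixes p :: "'n :: finite cpoly"
  assumes "p \<notin> polys_in {}"
  shows "\<exists>y. peval p y = 0"
proof -
  from assms obtain i where i: "degree (upoly i p) \<noteq> 0" by (auto simp: polys_in_def)
  then have "lead_coeff (upoly i p) \<noteq> 0" by auto
  then obtain y where y: "peval (lead_coeff (upoly i p)) y \<noteq> 0" using exists_peval_nonzero by blast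
  define r where "r = map_poly (\<lambda>a. peval a y) (upoly i p)"
  have "coeff r (degree (upoly i p)) \<noteq> 0" using y by (simp add: r_def coeff_map_poly)
  then have "degree (upoly i p) \<le> degree r" by (rule le_degree)
  with i have "\<not> constant (poly r)" by (simp add: constant_degree)
  then obtain t where "poly r t = 0" using fundamental_theorem_of_algebra by blast
  then have "peval p (y(i := t)) = 0" by (simp add: peval_fun_upd r_def)
  then show ?thesis by blast
qed

lemma X1_generic_factor_involves_var1:
  fixes P q :: "'n :: {finite, linorder} cpoly"
  assumes gen: "X1_generic P" and "q dvd P" "irreducible q"
  shows "degree (upoly var1 q) \<noteq> 0"
proof
  assume d: "degree (upoly var1 q) = 0"
  have "q \<notin> polys_in {}" using \<open>irreducible q\<close> is_unit_cpoly_iff by (auto simp: irreducible_def)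
  then obtain y where y: "peval q y = 0" using exists_peval_zero by blast
  have "peval q (y(var1 := t)) = 0" for t
    using y by (simp add: peval_fun_upd upoly_const [OF d] map_poly_pCons)
  then have "y(var1 := t) \<in> zero_locus P" for t
    using \<open>q dvd P\<close> by (auto simp: zero_locus_def peval_mult elim!: dvdE)
  moreover have "proj1 (y(var1 := t)) = proj1 y" for t
    by (auto simp: proj1_def restrict_def)
  \<comment> \<open>A whole line parallel to the first axis lies in a single fibre.\<close>
  ultimately have "range (\<lambda>t. y(var1 := t)) \<subseteq> {x \<in> zero_locus P. proj1 x = proj1 y}"
    by auto
  moreover have "finite {x \<in> zero_locus P. proj1 x = proj1 y}"
    using gen by (simp add: X1_generic_def)
  ultimately have "finite (range (\<lambda>t. y(var1 := t)))" by (rule finite_subset)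
  moreover have "inj (\<lambda>t. y(var1 := t))" by (auto intro!: injI dest: fun_cong [of _ _ var1])
  ultimately show False using finite_imageD infinite_UNIV_char_0 by blast
qed

section \<open>Partial derivatives and divisibility\<close>

lemma lookup_of_nat_mult:
  fixes p :: "'n cpoly"
  shows "Poly_Mapping.lookup (of_nat k * p) m = of_nat k * Poly_Mapping.lookup p m"
  by (induction k) (simp_all add: distrib_right lookup_add)

lemma upoly_pd: "upoly i (pd i p) = pderiv (upoly i p)"
  by (intro poly_eqI poly_mapping_eqI)
    (simp add: coeff_pderiv lookup_of_nat_mult lookup_coeff_upoly pd.rep_eq lookup_add add.assoc
      del: of_nat_Suc flip: single_add)

text \<open>In characteristic 0 the derivative is nonzero and of smaller degree in \<open>i\<close>,
  whereas a nonzero multiple of \<open>p\<close> has at least the degree of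
  \<open>p\<close>.\<close>

lemma not_dvd_pd:
  fixes p :: "'n :: linorder cpoly"
  assumes "degree (upoly i p) \<noteq> 0"
  shows "\<not> p dvd pd i p"
proof
  assume "p dvd pd i p"
  then obtain k where k: "pd i p = p * k" by blast
  have "pd i p \<noteq> 0"
  proof
    assume z: "pd i p = 0"
    have "Poly_Mapping.lookup p m = 0" if "Poly_Mapping.lookup m i \<noteq> 0" for m
    proof -
      have "m - Poly_Mapping.single i 1 + Poly_Mapping.single i 1 = m"
        using that by (intro poly_mapping_eqI) (auto simp: lookup_add lookup_minus lookup_single when_def)
      then have "Poly_Mapping.lookup (pd i p) (m - Poly_Mapping.single i 1) =
          of_nat (Poly_Mapping.lookup (m - Poly_Mapping.single i 1) i + 1) * Poly_Mapping.lookup p m"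
        by (simp add: pd.rep_eq)
      then show ?thesis using z by (simp del: of_nat_add of_nat_Suc)
    qed
    with assms show False by (simp add: degree_upoly_eq_0_iff)
  qed
  then have "p \<noteq> 0" "k \<noteq> 0" using k by auto
  then have "degree (upoly i p) \<le> degree (pderiv (upoly i p))"
    by (simp add: k degree_upoly_mult flip: upoly_pd)
  also have "\<dots> \<le> degree (upoly i p) - 1"
    by (intro degree_le) (auto simp: coeff_pderiv coeff_eq_0)
  finally show False using assms by simp
qed

section \<open>Divisibility by and of products of primes\<close>

lemma prime_elem_dvd_prod:
  fixes p :: "'a :: comm_semiring_1"
  assumes "prime_elem p" "p dvd prod f A"
  shows "\<exists>a\<in>A. p dvd f a"
  using assms(2)
proof (induction A rule: infinite_finite_induct)
  case (insert a A)
  then show ?case using assms(1) by (auto simp: prime_elem_dvd_mult_iff)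
\<comment> \<open>For infinite or empty \<open>A\<close> the product is 1, which no prime
  divides.\<close>
qed (use assms(1) in \<open>auto simp: prime_elem_def\<close>)

text \<open>A further prime does not divide the product of the earlier ones, so it must divide the
  cofactor.\<close>

lemma prod_primes_dvd:
  fixes f :: "'i \<Rightarrow> 'a :: idom"
  assumes "finite A" "\<And>i. i \<in> A \<Longrightarrow> prime_elem (f i)" "\<And>i. i \<in> A \<Longrightarrow> f i dvd u"
    and "\<And>i j. i \<in> A \<Longrightarrow> j \<in> A \<Longrightarrow> i \<noteq> j \<Longrightarrow> \<not> f i dvd f j"
  shows "prod f A dvd u"
  using assms
proof (induction A)
  case (insert a A)
  then obtain k where k: "u = prod f A * k" by (metis dvdE insertCI)
  have "\<not> f a dvd prod f A"
    using prime_elem_dvd_prod [of "f a" f A] insert by blast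
  moreover have "f a dvd prod f A * k" using insert.prems(2) [of a] k by simp
  ultimately have "f a dvd k" using insert.prems(1) [of a] by (simp add: prime_elem_dvd_mult_iff)
  then show ?case using insert.hyps by (auto simp: k algebra_simps mult_dvd_mono)
qed simp

text \<open>A prime \<open>f a\<close> dividing \<open>c * k\<close> but not \<open>c\<close>
  divides \<open>k\<close> and cancels. This yields the universal property of the gcd without
  factoring \<open>c\<close>.\<close>

lemma dvd_if_not_dvd_other_primes:
  fixes f :: "'i \<Rightarrow> 'a :: idom"
  assumes "finite A" "\<And>i. i \<in> A \<Longrightarrow> prime_elem (f i)" "\<And>i. i \<in> A \<Longrightarrow> \<not> f i dvd c"
    and "c dvd prod f A * q"
  shows "c dvd q"
  using assms
proof (induction A)
  case (insert a A)
  then have p: "prime_elem (f a)" "\<not> f a dvd c" by auto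
  obtain k where k: "f a * (prod f A * q) = c * k"
    using insert by (auto simp: mult.assoc elim!: dvdE)
  then have "f a dvd c * k" by (metis dvd_triv_left)
  with p obtain k' where k': "k = f a * k'" by (auto simp: prime_elem_dvd_mult_iff)
  have "f a * (prod f A * q) = f a * (c * k')" using k k' by (simp add: algebra_simps)
  then have "prod f A * q = c * k'" using p by (auto simp: prime_elem_def)
  then show ?case using insert by auto
qed simp

section \<open>Eigenvalues and factors\<close>

text \<open>\<open>S_map\<close> inverts multiplication by the class of \<open>pd var1 P\<close>, so
  the eigenvector equation becomes a congruence between \<open>v * u\<close> and
  \<open>Const c * u * pd var1 P\<close> modulo \<open>P\<close>.\<close>

lemma eigenvalueD:
  assumes "c \<in> eigenvalues P (E_bar P) (psi_map P v)"
  shows "\<exists>u. \<not> P dvd u \<and> P dvd u * (v - Const c * pd var1 P)"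
proof -
  from assms obtain u where u: "cls P u \<in> E_bar P" "cls P u \<noteq> \<zero>\<^bsub>Q_ring P\<^esub>"
    and eq: "psi_map P v (cls P u) = smultQ P c (cls P u)"
    unfolding eigenvalues_def E_bar_def by blast
  from eq u(1) have S: "S_map P (cls P (v * u)) = cls P (Const c * u)"
    by (simp add: psi_map_def phi_map_def smultQ_def cls_mult)
  \<comment> \<open>Outside \<open>E_tilde P\<close> the value of \<open>S_map P\<close> is the
    empty set, but a residue class is nonempty.\<close>
  have "Const c * u \<in> cls P (Const c * u)" by (simp add: cls_eq)
  with S have t: "cls P (v * u) \<in> E_tilde P" by (auto simp: S_map_def split: if_splits)
  then have "mulPX1 P (S_map P (cls P (v * u))) = cls P (v * u)"
    by (simp add: S_map_def f_inv_into_f mulPX1_image)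
  then have "P dvd Const c * u * pd var1 P - v * u"
    by (simp add: S mulPX1_def cls_mult cls_eq_iff)
  moreover have "u * (v - Const c * pd var1 P) = - (Const c * u * pd var1 P - v * u)"
    by (simp add: algebra_simps)
  ultimately have "P dvd u * (v - Const c * pd var1 P)" by (simp only: dvd_minus_iff)
  moreover have "\<not> P dvd u" using u(2) by (simp add: zero_Q_ring cls_eq_iff)
  ultimately show ?thesis by blast
qed

theorem proposition4p6:
  fixes P v :: "'n :: {finite, linorder} cpoly"
    and Pf :: "nat \<Rightarrow> 'n cpoly" and s :: nat and lam :: "nat \<Rightarrow> complex"
  assumes "card (UNIV :: 'n set) \<ge> 2"
    and "\<nexists>c. P = Const c"
    and "reduced_poly P"
    and "is_factorization P s Pf"
    and "X1_generic P"
    and "v \<in> E_space P"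
    and "bij_betw lam {1..s} (eigenvalues P (E_bar P) (psi_map P v))"
  shows "\<exists>\<sigma>. bij_betw \<sigma> {1..s} {1..s} \<and>
           (\<forall>i\<in>{1..s}. is_gcd (Pf (\<sigma> i)) P (v - Const (lam i) * pd var1 P))"
proof -
  let ?I = "{1..s}"
  define w where "w c = v - Const c * pd var1 P" for c
  have P: "P = prod Pf ?I" and irr: "\<And>i. i \<in> ?I \<Longrightarrow> irreducible (Pf i)"
    using assms(4) by (auto simp: is_factorization_def)
  then have prime: "\<And>i. i \<in> ?I \<Longrightarrow> prime_elem (Pf i)"
    by (auto intro: irreducible_imp_prime_elem_cpoly)
  \<comment> \<open>Between irreducibles, divisibility in one direction implies the other, which
    reducedness excludes.\<close>
  have ndvd: "\<not> Pf i dvd Pf j" if "i \<in> ?I" "j \<in> ?I" "i \<noteq> j" for i j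
    using assms(3,4) that irr irreducible_dvd_irreducible [of "Pf i" "Pf j"]
    unfolding reduced_poly_def by blast
  have split: "P = prod Pf (?I - {j}) * Pf j" if "j \<in> ?I" for j
    using that by (simp add: P prod.remove [of _ j] mult.commute)
  have dvdP: "Pf j dvd P" if "j \<in> ?I" for j
    using split [OF that] by (metis dvd_triv_right)
  have PX1: "\<not> Pf j dvd pd var1 P" if j: "j \<in> ?I" for j
  proof
    let ?R = "prod Pf (?I - {j})"
    assume "Pf j dvd pd var1 P"
    \<comment> \<open>By the product rule, only the term \<open>?R * pd var1 (Pf j)\<close> survives
      modulo \<open>Pf j\<close>.\<close>
    then have "Pf j dvd pd var1 ?R * Pf j + ?R * pd var1 (Pf j)"
      by (subst (asm) split [OF j]) (simp only: pd_mult)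
    then have "Pf j dvd ?R * pd var1 (Pf j)" by (simp add: dvd_add_right_iff)
    moreover have "\<not> Pf j dvd ?R" using prime_elem_dvd_prod [OF prime [OF j]] ndvd j by blast
    ultimately have "Pf j dvd pd var1 (Pf j)" using prime [OF j] by (simp add: prime_elem_dvd_mult_iff)
    with not_dvd_pd X1_generic_factor_involves_var1 [OF assms(5) dvdP irr] j show False by blast
  qed
  have Const_diff: "w c - w d = Const (d - c) * pd var1 P" for c d
    by (simp add: w_def Const_def single_diff algebra_simps)
  \<comment> \<open>The difference of \<open>w c\<close> and \<open>w d\<close> is a constant
    multiple of \<open>pd var1 P\<close>, with nonzero constant when \<open>c\<close> and
    \<open>d\<close> differ.\<close>
  have unique: "c = d" if j: "j \<in> ?I" and dvd: "Pf j dvd w c" "Pf j dvd w d" for j c d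
  proof (rule ccontr)
    assume "c \<noteq> d"
    have "Pf j dvd Const (d - c) * pd var1 P" using dvd dvd_diff Const_diff by metis
    then have "Pf j dvd Const (inverse (d - c)) * (Const (d - c) * pd var1 P)" by (rule dvd_mult)
    also have "Const (inverse (d - c)) * (Const (d - c) * pd var1 P) = pd var1 P"
      using \<open>c \<noteq> d\<close> by (simp add: Const_def mult_single flip: mult.assoc)
    finally show False using PX1 [OF j] by simp
  qed
  \<comment> \<open>If every \<open>Pf j\<close> divided \<open>u\<close>, so would their product
    \<open>P\<close>. A factor not dividing \<open>u\<close> must, being prime, divide
    \<open>w (lam i)\<close>.\<close>
  have "\<exists>j\<in>?I. Pf j dvd w (lam i)" if "i \<in> ?I" for i
  proof -
    have "lam i \<in> eigenvalues P (E_bar P) (psi_map P v)"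
      using assms(7) that by (auto simp: bij_betw_def)
    then obtain u where u: "\<not> P dvd u" "P dvd u * w (lam i)"
      using eigenvalueD unfolding w_def by blast
    then obtain j where j: "j \<in> ?I" "\<not> Pf j dvd u"
      using prod_primes_dvd [of ?I Pf u] prime ndvd P by blast
    with u(2) dvdP have "Pf j dvd u * w (lam i)" by (meson dvd_trans)
    with j prime show ?thesis by (auto simp: prime_elem_dvd_mult_iff)
  qed
  then obtain \<sigma> where \<sigma>: "\<And>i. i \<in> ?I \<Longrightarrow> \<sigma> i \<in> ?I" "\<And>i. i \<in> ?I \<Longrightarrow> Pf (\<sigma> i) dvd w (lam i)"
    by metis
  have "inj_on lam ?I" using assms(7) by (rule bij_betw_imp_inj_on)
  \<comment> \<open>A factor assigned to two indices would divide \<open>w\<close> at both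
    eigenvalues, making these equal.\<close>
  then have inj: "inj_on \<sigma> ?I" using unique \<sigma> by (metis inj_on_def)
  moreover have "\<sigma> ` ?I = ?I" using inj \<sigma>(1) by (intro endo_inj_surj) auto
  ultimately have bij: "bij_betw \<sigma> ?I ?I" by (simp add: bij_betw_def)
  have "is_gcd (Pf (\<sigma> i)) P (w (lam i))" if i: "i \<in> ?I" for i
    unfolding is_gcd_def
  proof (intro conjI allI impI)
    show "Pf (\<sigma> i) dvd P" "Pf (\<sigma> i) dvd w (lam i)" using \<sigma> i dvdP by auto
    fix c assume c: "c dvd P \<and> c dvd w (lam i)"
    show "c dvd Pf (\<sigma> i)"
    proof (rule dvd_if_not_dvd_other_primes)
      show "c dvd prod Pf (?I - {\<sigma> i}) * Pf (\<sigma> i)" using c split \<sigma>(1) [OF i] by metis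
      fix j assume j: "j \<in> ?I - {\<sigma> i}"
      then show "prime_elem (Pf j)" using prime by blast
      from j \<open>\<sigma> ` ?I = ?I\<close> obtain k where k: "k \<in> ?I" "j = \<sigma> k" by (metis DiffD1 imageE)
      \<comment> \<open>\<open>Pf j\<close> is already assigned to an index \<open>k\<close> other
        than \<open>i\<close>; dividing \<open>c\<close>, it would also divide
        \<open>w (lam i)\<close>.\<close>
      show "\<not> Pf j dvd c"
      proof
        assume "Pf j dvd c"
        then have "Pf j dvd w (lam i)" using c dvd_trans by blast
        then have "lam k = lam i" using unique \<sigma> k j by blast
        then have "k = i" using \<open>inj_on lam ?I\<close> k i by (meson inj_onD)
        with j k show False by simp
      qed
    qed simp
  qed
  with bij show ?thesis unfolding w_def by blast
qed

end
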